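(* Let $r\in(0,1)$ and $A_r=\{z\in\mathbb{C}: r<|z|<1\}$. Then the injectivity radius of $A_r$ with respect to the Kobayashi distance is $$\iota^k_{A_r}=\frac{1-\lambda}{1+\lambda},\qquad\text{where }\lambda=\exp\left(\frac{\pi^2}{\ln r}\right).$$
   Context: $\mathbb{D}$ is the open unit disk in $\mathbb{C}$, and $\rho_{\mathbb{D}}$ is the Poincaré distance on $\mathbb{D}$ with density $\frac{2}{1-|z|^2}$. For a Riemann surface $X$, the Kobayashi pseudo-distance is $k_X(z_1,z_2)=\inf \sum_{i=1}^m\rho_{\mathbb{D}}(a_i,b_i)$, the infimum over all $m\ge1$, $a_i,b_i\in\mathbb{D}$ and holomorphic $f_i:\mathbb{D}\to X$ with $f_1(a_1)=z_1$, $f_i(b_i)=f_{i+1}(a_{i+1})$ for $1\le i<m$, and $f_m(b_m)=z_2$. Put $B^k_X(z;s)=\{w\in X: k_X(z,w)<s\}$. The injectivity radius function is $\iota^k_X(z)=\sup\{\tanh\frac s2 : s>0,\ B^k_X(z;s)\text{ is simply connected}\}$, and the injectivity radius is $\iota^k_X=\inf_{z\in X}\iota^k_X(z)$. *)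

theory Defs
  imports "HOL-Complex_Analysis.Complex_Analysis"
begin

definition poincare_density :: "complex \<Rightarrow> real" where
  "poincare_density z = 2 / (1 - (norm z)\<^sup>2)"

definition poincare_speed :: "(real \<Rightarrow> complex) \<Rightarrow> real \<Rightarrow> real" where
  "poincare_speed g t = poincare_density (g t) * norm (vector_derivative g (at t within {0..1}))"

definition poincare_length :: "(real \<Rightarrow> complex) \<Rightarrow> real" where
  "poincare_length g = integral {0..1} (poincare_speed g)"

text \<open>The distance is the infimum of the lengths of piecewise continuously differentiable paths in
  the unit disk. A \<^const>\<open>valid_path\<close> may have unbounded derivative near its finitely many exceptional
  parameters and hence infinite length, in which case \<^const>\<open>integral\<close> returns the default value 0.
  The integrability condition discards such paths, as they should count as having length infinity.\<close>

definition poincare_dist :: "complex \<Rightarrow> complex \<Rightarrow> real" where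
  "poincare_dist a b =
     Inf {poincare_length g | g. valid_path g \<and> path_image g \<subseteq> ball 0 1 \<and>
                                 pathstart g = a \<and> pathfinish g = b \<and>
                                 poincare_speed g integrable_on {0..1}}"

text \<open>Riemann surfaces are represented here by nonempty connected open subsets \<open>X\<close> of the complex
  plane. For such \<open>X\<close> and \<open>z1, z2 \<in> X\<close> the set of chain lengths below is nonempty and bounded below
  by 0, so the real-valued infimum is the intended one; similarly for the suprema and
  infima in the injectivity radius when \<open>X\<close> is a bounded domain.\<close>

definition kobayashi_chain ::
  "complex set \<Rightarrow> complex \<Rightarrow> complex \<Rightarrow> nat \<Rightarrow> (nat \<Rightarrow> complex) \<Rightarrow> (nat \<Rightarrow> complex) \<Rightarrow>
   (nat \<Rightarrow> complex \<Rightarrow> complex) \<Rightarrow> bool" where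
  "kobayashi_chain X z1 z2 m a b f \<longleftrightarrow>
     m \<ge> 1 \<and>
     (\<forall>i\<in>{1..m}. a i \<in> ball 0 1 \<and> b i \<in> ball 0 1 \<and>
                 f i holomorphic_on ball 0 1 \<and> f i ` ball 0 1 \<subseteq> X) \<and>
     f 1 (a 1) = z1 \<and>
     (\<forall>i\<in>{1..<m}. f i (b i) = f (i + 1) (a (i + 1))) \<and>
     f m (b m) = z2"

definition kobayashi_dist :: "complex set \<Rightarrow> complex \<Rightarrow> complex \<Rightarrow> real" where
  "kobayashi_dist X z1 z2 =
     Inf {\<Sum>i=1..m. poincare_dist (a i) (b i) | m a b f. kobayashi_chain X z1 z2 m a b f}"

definition kobayashi_ball :: "complex set \<Rightarrow> complex \<Rightarrow> real \<Rightarrow> complex set" where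
  "kobayashi_ball X z s = {w \<in> X. kobayashi_dist X z w < s}"

definition kobayashi_injrad_at :: "complex set \<Rightarrow> complex \<Rightarrow> real" where
  "kobayashi_injrad_at X z =
     Sup {tanh (s / 2) | s. s > 0 \<and> simply_connected (kobayashi_ball X z s)}"

definition kobayashi_injrad :: "complex set \<Rightarrow> real" where
  "kobayashi_injrad X = (INF z\<in>X. kobayashi_injrad_at X z)"

definition round_annulus :: "real \<Rightarrow> complex set" where
  "round_annulus r = {z. r < norm z \<and> norm z < 1}"

end

theory Submission
  imports Defs
begin

text \<open>
  With \<open>L = - ln r\<close>, the exponential map covers the annulus by the strip \<open>- L < Re \<zeta> < 0\<close>, whose
  hyperbolic density is at least \<open>\<pi> / L\<close>, with equality exactly on the central line. Holomorphic
  disks lift to the strip, so by the Schwarz--Pick lemma a Kobayashi ball of radius \<open>s\<close> is the image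
  of a hyperbolic disk of radius \<open>s\<close>. For \<open>s = \<pi>\<^sup>2 / L\<close> imaginary parts vary on that disk by less
  than \<open>\<pi>\<close> from the centre, so the covering is injective on it and the ball is simply connected. Around
  a point of the core circle \<open>norm z = sqrt r\<close>, every larger ball contains the whole core circle and
  hence is not simply connected.
\<close>

section \<open>The Poincar\'e distance and the Schwarz--Pick lemma\<close>

text \<open>In the quotient rule the term containing the numerator drops out at \<open>w\<close>.
  Together with the derivative at 0 computed next, this supplies the outer factors of the chain rule
  in \<open>Schwarz_Pick_deriv\<close>.\<close>

lemma has_field_derivative_Moebius_function_self:
  assumes "norm w < 1"
  shows "(Moebius_function 0 w has_field_derivative of_real (1 / (1 - (norm w)\<^sup>2))) (at w)"
proof -
  have ww: "cnj w * w = of_real ((norm w)\<^sup>2)"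
    by (metis complex_norm_square mult.commute)
  have lt: "(norm w)\<^sup>2 < 1"
    using assms by (simp add: abs_square_less_1)
  have nz: "1 - cnj w * w \<noteq> 0"
    unfolding ww using lt
    by (metis eq_iff_diff_eq_0 less_irrefl of_real_1 of_real_eq_iff)
  have "((\<lambda>z. (z - w) / (1 - cnj w * z)) has_field_derivative
      (1 * (1 - cnj w * w) - (w - w) * (- cnj w)) / ((1 - cnj w * w) * (1 - cnj w * w))) (at w)"
    using nz by (auto intro!: derivative_eq_intros)
  moreover have "(1 * (1 - cnj w * w) - (w - w) * (- cnj w)) / ((1 - cnj w * w) * (1 - cnj w * w))
      = of_real (1 / (1 - (norm w)\<^sup>2))"
    using nz by (simp add: ww)
  ultimately show ?thesis
    by (simp add: Moebius_function_simple [abs_def])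
qed

lemma has_field_derivative_Moebius_function_0:
  "(Moebius_function 0 (-w) has_field_derivative of_real (1 - (norm w)\<^sup>2)) (at 0)"
proof -
  have ww: "w * cnj w = of_real ((norm w)\<^sup>2)"
    by (metis complex_norm_square)
  have "((\<lambda>z. (z - (-w)) / (1 - cnj (-w) * z)) has_field_derivative
      (1 - w * cnj w)) (at 0)"
    by (auto intro!: derivative_eq_intros)
  then show ?thesis
    by (simp add: Moebius_function_simple [abs_def] ww)
qed

text \<open>Disk automorphisms taking 0 to \<open>z\<close> and \<open>f z\<close> to 0 conjugate
  \<open>f\<close> into a self-map \<open>F\<close> fixing 0. The Schwarz lemma gives
  \<open>norm (deriv F 0) \<le> 1\<close>, which the chain rule turns into the claim.\<close>

lemma Schwarz_Pick_deriv:
  assumes holf: "f holomorphic_on ball 0 1" and imf: "f ` ball 0 1 \<subseteq> ball 0 1" and z: "norm z < 1"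
  shows "norm (deriv f z) * (1 - (norm z)\<^sup>2) \<le> 1 - (norm (f z))\<^sup>2"
proof -
  define w where "w = f z"
  have w: "norm w < 1" using imf z by (force simp: w_def)
  define F where "F = Moebius_function 0 w \<circ> (f \<circ> Moebius_function 0 (-z))"
  have zz: "norm (-z) < 1" using z by simp
  have Mz: "Moebius_function 0 (-z) ` ball 0 1 \<subseteq> ball 0 1"
    using Moebius_function_norm_lt_1 [OF zz] by auto
  have fM: "(f \<circ> Moebius_function 0 (-z)) ` ball 0 1 \<subseteq> ball 0 1"
    using Mz imf by (auto simp: image_subset_iff)
  have "f \<circ> Moebius_function 0 (-z) holomorphic_on ball 0 1"
    by (rule holomorphic_on_compose_gen [OF Moebius_function_holomorphic [OF zz] holf Mz])
  then have holF: "F holomorphic_on ball 0 1"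
    unfolding F_def by (rule holomorphic_on_compose_gen [OF _ Moebius_function_holomorphic [OF w] fM])
  have M0: "Moebius_function 0 (-z) 0 = z" by (simp add: Moebius_function_of_zero)
  have F0: "F 0 = 0" by (simp add: F_def M0 w_def Moebius_function_eq_zero)
  have Flt: "norm (F u) < 1" if "norm u < 1" for u
    using Moebius_function_norm_lt_1 [OF w] fM that by (auto simp: F_def image_subset_iff)
  have df: "(f has_field_derivative deriv f z) (at z)"
    using holf z by (intro holomorphic_derivI [of f "ball 0 1"]) auto
  have "(F has_field_derivative
      of_real (1 / (1 - (norm w)\<^sup>2)) * (deriv f z * of_real (1 - (norm z)\<^sup>2))) (at 0)"
    unfolding F_def
    by (intro DERIV_chain has_field_derivative_Moebius_function_0)
       (use has_field_derivative_Moebius_function_self [OF w] df in \<open>simp_all add: M0 w_def\<close>)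
  then have eq: "deriv F 0 = of_real (1 / (1 - (norm w)\<^sup>2)) * (deriv f z * of_real (1 - (norm z)\<^sup>2))"
    by (rule DERIV_imp_deriv)
  have lt: "(norm w)\<^sup>2 < 1" "(norm z)\<^sup>2 < 1"
    using w z by (simp_all add: abs_square_less_1)
  have "norm (deriv F 0) \<le> 1"
    using Schwarz_Lemma(2) [OF holF F0 Flt, of 0] by simp
  then have "norm (deriv f z) * (1 - (norm z)\<^sup>2) / (1 - (norm w)\<^sup>2) \<le> 1"
    unfolding eq norm_mult norm_of_real using lt by simp
  then show ?thesis
    using lt by (simp add: w_def [symmetric] divide_le_eq)
qed

text \<open>The differential of \<open>2 artanh \<circ> Re\<close> is dominated by the Poincar\'e density, since
  \<open>\<bar>Re w\<bar> \<le> norm w\<close>.\<close>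

lemma artanh_Re_diff_le_poincare_length:
  assumes holf: "f holomorphic_on ball 0 1" and imf: "f ` ball 0 1 \<subseteq> ball 0 1"
    and g: "valid_path g" "path_image g \<subseteq> ball 0 1" "poincare_speed g integrable_on {0..1}"
  shows "2 * artanh (Re (f (pathfinish g))) - 2 * artanh (Re (f (pathstart g))) \<le> poincare_length g"
proof -
  obtain S where contg: "continuous_on {0..1} g" and S: "finite S" "g C1_differentiable_on ({0..1} - S)"
    using g(1) by (auto simp: valid_path_def piecewise_C1_differentiable_on_def)
  have g_in: "norm (g t) < 1" if "t \<in> {0..1}" for t
    using g(2) that unfolding path_image_def by fastforce
  have f_in: "norm (f w) < 1" if "norm w < 1" for w
    using imf that by force
  have Re_lt: "\<bar>Re (f w)\<bar> < 1" if "norm w < 1" for w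
    using abs_Re_le_cmod [of "f w"] f_in [OF that] by linarith
  define \<phi> where "\<phi> t = 2 * artanh (Re (f (g t)))" for t
  define \<phi>' where
    "\<phi>' t = 2 * Re (vector_derivative g (at t) * deriv f (g t)) / (1 - (Re (f (g t)))\<^sup>2)" for t
  have contf: "continuous_on (ball 0 1) f"
    using holf by (rule holomorphic_on_imp_continuous_on)
  have "continuous_on {0..1} (\<lambda>t. f (g t))"
    using continuous_on_compose2 [OF contf contg] g_in by (force simp: image_subset_iff)
  moreover have "Re (f (g x)) \<in> {-1<..<1}" if "x \<in> {0..1}" for x
    using Re_lt [OF g_in [OF that]] by auto
  ultimately have cont: "continuous_on {0..1} \<phi>"
    unfolding \<phi>_def by (intro continuous_intros) auto
  have deriv: "(\<phi> has_vector_derivative \<phi>' t) (at t)" if t: "t \<in> {0<..<1} - S" for t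
  proof -
    have "g differentiable (at t)"
      using S t by (auto simp: C1_differentiable_on_eq)
    then have dg: "(g has_vector_derivative vector_derivative g (at t)) (at t)"
      by (simp add: vector_derivative_works)
    have gt: "norm (g t) < 1" using g_in t by auto
    have df: "(f has_field_derivative deriv f (g t)) (at (g t))"
      using holf gt by (intro holomorphic_derivI [of f "ball 0 1"]) auto
    have "(f \<circ> g has_vector_derivative vector_derivative g (at t) * deriv f (g t)) (at t)"
      by (rule field_vector_diff_chain_at [OF dg df])
    from bounded_linear.has_vector_derivative [OF bounded_linear_Re this]
    have "((\<lambda>t. Re (f (g t))) has_vector_derivative
        Re (vector_derivative g (at t) * deriv f (g t))) (at t)"
      by (simp only: o_def)
    then have dR: "((\<lambda>t. Re (f (g t))) has_field_derivative
        Re (vector_derivative g (at t) * deriv f (g t))) (at t)"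
      by (simp add: has_real_derivative_iff_has_vector_derivative)
    have "((\<lambda>t. 2 * artanh (Re (f (g t)))) has_field_derivative
        2 * (1 / (1 - (Re (f (g t)))\<^sup>2) * Re (vector_derivative g (at t) * deriv f (g t)))) (at t)"
      by (intro DERIV_cmult DERIV_chain2 [OF artanh_real_has_field_derivative dR] Re_lt gt)
    then have "(\<phi> has_field_derivative \<phi>' t) (at t)"
      by (simp only: \<phi>_def [abs_def] \<phi>'_def times_divide_eq_left times_divide_eq_right mult_1_left)
    then show ?thesis
      by (simp add: has_real_derivative_iff_has_vector_derivative)
  qed
  \<comment> \<open>Continuity of \<open>\<phi>\<close> lets the fundamental theorem ignore the
    finitely many parameters in \<open>S\<close>.\<close>
  have int1: "(\<phi>' has_integral (\<phi> 1 - \<phi> 0)) {0..1}"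
    by (rule fundamental_theorem_of_calculus_interior_strong [OF S(1) _ deriv cont]) auto
  have int2: "(poincare_speed g has_integral poincare_length g) {0..1}"
    using g(3) by (simp add: poincare_length_def integrable_integral)
  \<comment> \<open>In the open interval the derivative within \<open>{0..1}\<close> used by
    \<open>poincare_speed\<close> agrees with the two-sided one in \<open>\<phi>'\<close>. The
    endpoints do not affect the integrals.\<close>
  have le: "\<phi>' t \<le> poincare_speed g t" if t: "t \<in> {0<..<1}" for t
  proof -
    have gt: "norm (g t) < 1" using g_in t by auto
    let ?v = "vector_derivative g (at t)"
    have vd: "vector_derivative g (at t within {0..1}) = ?v"
    proof -
      have "at t within {0..1} = at t"
        using t by (intro at_within_interior) auto
      then show ?thesis by simp
    qed
    have pos: "0 < 1 - (norm (g t))\<^sup>2" "0 < 1 - (norm (f (g t)))\<^sup>2"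
      using gt f_in [OF gt] by (simp_all add: abs_square_less_1)
    have "Re (?v * deriv f (g t)) \<le> norm ?v * norm (deriv f (g t))"
      by (metis complex_Re_le_cmod norm_mult)
    then have "\<phi>' t \<le> 2 * (norm ?v * norm (deriv f (g t))) / (1 - (Re (f (g t)))\<^sup>2)"
      unfolding \<phi>'_def using Re_lt [OF gt]
      by (intro divide_right_mono mult_left_mono) (auto simp: abs_square_le_1)
    also have "\<dots> \<le> 2 * (norm ?v * norm (deriv f (g t))) / (1 - (norm (f (g t)))\<^sup>2)"
    proof (intro divide_left_mono)
      have "(Re (f (g t)))\<^sup>2 \<le> (norm (f (g t)))\<^sup>2"
        by (metis abs_Re_le_cmod abs_ge_zero power2_abs power_mono)
      then show "1 - (norm (f (g t)))\<^sup>2 \<le> 1 - (Re (f (g t)))\<^sup>2" by simp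
      then show "0 < (1 - (Re (f (g t)))\<^sup>2) * (1 - (norm (f (g t)))\<^sup>2)"
        using pos by (intro mult_pos_pos) linarith+
    qed auto
    also have "\<dots> = 2 * norm ?v * (norm (deriv f (g t)) / (1 - (norm (f (g t)))\<^sup>2))"
      by simp
    also have "\<dots> \<le> 2 * norm ?v * (1 / (1 - (norm (g t))\<^sup>2))"
      using Schwarz_Pick_deriv [OF holf imf gt] pos
      by (intro mult_left_mono) (auto simp: field_simps)
    also have "\<dots> = poincare_speed g t"
      by (simp add: poincare_speed_def poincare_density_def vd)
    finally show ?thesis .
  qed
  have "\<phi> 1 - \<phi> 0 \<le> poincare_length g"
    using int1 int2 le unfolding has_integral_Icc_iff_Ioo by (rule has_integral_le)
  then show ?thesis
    by (simp add: \<phi>_def pathstart_def pathfinish_def)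
qed

section \<open>Segments and bounds for the Poincare distance\<close>

lemma linepath_in_unit_ball:
  fixes a b :: complex
  assumes "norm a < 1" "norm b < 1"
  shows "path_image (linepath a b) \<subseteq> ball 0 1"
  using assms by (simp add: closed_segment_subset)

lemma poincare_speed_linepath:
  assumes "t \<in> {0..1}"
  shows "poincare_speed (linepath a b) t = 2 * norm (b - a) / (1 - (norm (linepath a b t))\<^sup>2)"
  using assms by (simp add: poincare_speed_def poincare_density_def vector_derivative_linepath_within)

text \<open>The segment stays inside the open disk, so its speed is continuous. Segments witness
  that the set in \<open>poincare_dist\<close> is nonempty.\<close>

lemma poincare_speed_linepath_integrable:
  assumes "norm a < 1" "norm b < 1"
  shows "poincare_speed (linepath a b) integrable_on {0..1}"
proof -
  have "(norm (linepath a b t))\<^sup>2 \<noteq> 1" if "t \<in> {0..1}" for t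
  proof -
    have "norm (linepath a b t) < 1"
      using linepath_in_unit_ball [OF assms] that unfolding path_image_def by fastforce
    then show ?thesis by (simp add: abs_square_less_1 less_imp_neq)
  qed
  then have "continuous_on {0..1} (\<lambda>t. 2 * norm (b - a) / (1 - (norm (linepath a b t))\<^sup>2))"
    by (intro continuous_intros continuous_on_linepath) auto
  then have "(\<lambda>t. 2 * norm (b - a) / (1 - (norm (linepath a b t))\<^sup>2)) integrable_on {0..1}"
    by (rule integrable_continuous_real)
  then show ?thesis
    by (rule integrable_eq) (simp add: poincare_speed_linepath)
qed

text \<open>The bound holds for every admissible path, hence for the infimum. Letting
  \<open>f\<close> vary makes this a family of lower bounds that stands in for a closed formula for
  the distance.\<close>

lemma artanh_Re_diff_le_poincare_dist:
  assumes "f holomorphic_on ball 0 1" "f ` ball 0 1 \<subseteq> ball 0 1" "norm a < 1" "norm b < 1"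
  shows "2 * artanh (Re (f b)) - 2 * artanh (Re (f a)) \<le> poincare_dist a b"
  unfolding poincare_dist_def
proof (rule cInf_greatest)
  have "valid_path (linepath a b)" by simp
  then show "{poincare_length g |g. valid_path g \<and> path_image g \<subseteq> ball 0 1 \<and> pathstart g = a \<and>
      pathfinish g = b \<and> poincare_speed g integrable_on {0..1}} \<noteq> {}"
    using linepath_in_unit_ball [OF assms(3,4)] poincare_speed_linepath_integrable [OF assms(3,4)]
    by (metis (mono_tags, lifting) Collect_empty_eq pathfinish_linepath pathstart_linepath)
qed (use artanh_Re_diff_le_poincare_length [OF assms(1,2)] in auto)

lemma poincare_dist_nonneg:
  assumes "norm a < 1" "norm b < 1"
  shows "0 \<le> poincare_dist a b"
  using artanh_Re_diff_le_poincare_dist [of "\<lambda>_. 0", OF _ _ assms] by (simp add: image_subset_iff)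

text \<open>The antiderivative is \<open>artanh (t * R)\<close>. The integral serves both for the
  length of a radius and for the growth estimate of maps into the strip.\<close>

lemma has_integral_artanh_radius:
  fixes R :: real
  assumes "0 \<le> R" "R < 1"
  shows "((\<lambda>t. R / (1 - (t * R)\<^sup>2)) has_integral artanh R) {0..1}"
proof -
  have "((\<lambda>t. artanh (t * R)) has_vector_derivative R / (1 - (t * R)\<^sup>2)) (at t within {0..1})"
    if t: "t \<in> {0..1}" for t
  proof -
    have "t * R \<le> 1 * R" using t assms by (intro mult_right_mono) auto
    then have "\<bar>t * R\<bar> < 1" using t assms by (simp add: abs_mult)
    then have "(artanh has_field_derivative 1 / (1 - (t * R)\<^sup>2)) (at (t * R))"
      by (rule artanh_real_has_field_derivative)
    moreover have "((\<lambda>t. t * R) has_field_derivative R) (at t within {0..1})"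
      by (auto intro!: derivative_eq_intros)
    ultimately show ?thesis
      unfolding has_real_derivative_iff_has_vector_derivative [symmetric]
      by (auto dest: DERIV_chain2)
  qed
  from fundamental_theorem_of_calculus [OF _ this] show ?thesis by simp
qed

text \<open>The radial segment from 0 to \<open>w\<close> has exactly this length.\<close>

lemma poincare_dist_0_le:
  assumes "norm w < 1"
  shows "poincare_dist 0 w \<le> 2 * artanh (norm w)"
proof -
  have "((\<lambda>t. 2 * (norm w / (1 - (t * norm w)\<^sup>2))) has_integral 2 * artanh (norm w)) {0..1}"
    by (intro has_integral_mult_right has_integral_artanh_radius assms norm_ge_zero)
  moreover have "2 * (norm w / (1 - (t * norm w)\<^sup>2)) = poincare_speed (linepath 0 w) t"
    if "t \<in> {0..1}" for t
    unfolding poincare_speed_linepath [OF that] using that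
    by (simp add: linepath_def abs_mult power_mult_distrib)
  ultimately have "(poincare_speed (linepath 0 w) has_integral 2 * artanh (norm w)) {0..1}"
    by (rule has_integral_eq [rotated])
  then have "poincare_length (linepath 0 w) = 2 * artanh (norm w)"
    unfolding poincare_length_def by (rule integral_unique)
  moreover have "poincare_dist 0 w \<le> poincare_length (linepath 0 w)"
    unfolding poincare_dist_def
  proof (rule cInf_lower)
    show "poincare_length (linepath 0 w) \<in> {poincare_length g |g. valid_path g \<and>
        path_image g \<subseteq> ball 0 1 \<and> pathstart g = 0 \<and> pathfinish g = w \<and>
        poincare_speed g integrable_on {0..1}}"
      using linepath_in_unit_ball [of 0 w] poincare_speed_linepath_integrable [of 0 w] assms
      by (intro CollectI exI [of _ "linepath 0 w"]) auto
    have "0 \<le> poincare_length g" if "valid_path g" "path_image g \<subseteq> ball 0 1"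
      "poincare_speed g integrable_on {0..1}" for g
      using artanh_Re_diff_le_poincare_length [of "\<lambda>_. 0", OF _ _ that] by (simp add: image_subset_iff)
    then show "bdd_below {poincare_length g |g. valid_path g \<and>
        path_image g \<subseteq> ball 0 1 \<and> pathstart g = 0 \<and> pathfinish g = w \<and>
        poincare_speed g integrable_on {0..1}}"
      by (intro bdd_belowI [of _ 0]) auto
  qed
  ultimately show ?thesis by simp
qed

section \<open>A vertical strip as a model of the disk\<close>

text \<open>This is the preimage of \<open>round_annulus (exp (- L))\<close> under
  \<open>exp\<close>.\<close>

definition vstrip :: "real \<Rightarrow> complex set" where
  "vstrip L = {\<zeta>. - L < Re \<zeta> \<and> Re \<zeta> < 0}"

text \<open>\<open>Arctan\<close> maps the unit disk conformally onto the strip where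
  \<open>\<bar>Re z\<bar> < pi / 4\<close>. The affine map rescales its width to \<open>L\<close>
  and moves the image of 0 to \<open>- L / 2\<close>, on the central line. The inverse is
  \<open>disk_of_strip\<close>.\<close>

definition strip_of_disk :: "real \<Rightarrow> complex \<Rightarrow> complex" where
  "strip_of_disk L w = of_real (2 * L / pi) * Arctan w - of_real (L / 2)"

definition disk_of_strip :: "real \<Rightarrow> complex \<Rightarrow> complex" where
  "disk_of_strip L \<zeta> = tan (of_real (pi / (2 * L)) * (\<zeta> + of_real (L / 2)))"

text \<open>Dividing \<open>(norm (cos z))\<^sup>2 - (norm (sin z))\<^sup>2 = cos (2 * Re z)\<close>
  by \<open>(norm (cos z))\<^sup>2\<close>. The sign tells when \<open>tan z\<close> lies in the
  disk, and the value yields the density of the strip.\<close>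

lemma one_minus_norm_tan_squared:
  fixes z :: complex
  assumes "cos z \<noteq> 0"
  shows "1 - (norm (tan z))\<^sup>2 = cos (2 * Re z) / (norm (cos z))\<^sup>2"
proof -
  have "(norm (cos z))\<^sup>2 - (norm (sin z))\<^sup>2 = cos (2 * Re z)"
  proof -
    have "(exp (Im z) - inverse (exp (Im z)))\<^sup>2 = exp (2 * Im z) + inverse (exp (2 * Im z)) - 2"
      by (simp add: exp_double power2_diff power_inverse)
    \<comment> \<open>Here \<open>c\<close> stands for \<open>(cos (Re z))\<^sup>2\<close>, and
      \<open>E\<close>, \<open>E'\<close> for \<open>exp (2 * Im z)\<close> and its inverse.\<close>
    moreover have "c + (E + E' - 2) / 4 - (E + E' - 2 * (c - (1 - c))) / 4 = c - (1 - c)"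
      for c E E' :: real
      by (simp add: field_simps)
    ultimately show ?thesis
      by (simp only: norm_cos_squared norm_sin_squared cos_double sin_squared_eq)
  qed
  moreover have "1 - (norm (tan z))\<^sup>2 = ((norm (cos z))\<^sup>2 - (norm (sin z))\<^sup>2) / (norm (cos z))\<^sup>2"
    using assms by (simp add: tan_def norm_divide power_divide diff_divide_distrib)
  ultimately show ?thesis
    by simp
qed

lemma cos_nonzero_of_Re:
  assumes "\<bar>Re z\<bar> < pi / 2"
  shows "cos z \<noteq> 0"
proof
  assume "cos z = 0"
  then have "(cos (Re z))\<^sup>2 + ((exp (Im z) - inverse (exp (Im z)))\<^sup>2 / 4) = 0"
    using norm_cos_squared [of z] by simp
  moreover have "0 \<le> (exp (Im z) - inverse (exp (Im z)))\<^sup>2 / 4"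
    by simp
  ultimately have "(cos (Re z))\<^sup>2 \<le> 0"
    by linarith
  then have "cos (Re z) = 0"
    by simp
  moreover have "0 < cos (Re z)"
    using assms by (intro cos_gt_zero_pi) auto
  ultimately show False by simp
qed

text \<open>Excludes the singularities \<open>\<i>\<close> and \<open>- \<i>\<close> of
  \<open>Arctan\<close>, which lie on the unit circle, so that \<open>tan_Arctan\<close>
  applies.\<close>

lemma square_neq_minus_1:
  fixes w :: complex
  assumes "norm w < 1"
  shows "w\<^sup>2 \<noteq> -1"
proof
  assume "w\<^sup>2 = -1"
  then have "(norm w)\<^sup>2 = 1" by (metis norm_minus_cancel norm_one norm_power)
  then show False using assms abs_square_less_1 [of "norm w"] by simp
qed

context
  fixes L :: real
  assumes L: "0 < L"
begin

text \<open>With \<open>pi / 4\<close> as the bound, doubling the real part stays below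
  \<open>pi / 2\<close>, where \<open>cos\<close> is positive. This is what puts the values of
  \<open>disk_of_strip\<close> in the unit disk.\<close>

lemma Re_scaled_vstrip:
  assumes "\<zeta> \<in> vstrip L"
  shows "\<bar>Re (of_real (pi / (2 * L)) * (\<zeta> + of_real (L / 2)))\<bar> < pi / 4"
proof -
  have "Re (of_real (pi / (2 * L)) * (\<zeta> + of_real (L / 2))) = pi / (2 * L) * (Re \<zeta> + L / 2)"
    by simp
  moreover have "\<bar>pi / (2 * L) * (Re \<zeta> + L / 2)\<bar> < pi / (2 * L) * (L / 2)"
    unfolding abs_mult using assms L
    by (subst abs_of_pos, simp, intro mult_strict_left_mono) (auto simp: vstrip_def abs_if)
  moreover have "pi / (2 * L) * (L / 2) = pi / 4"
    using L by simp
  ultimately show ?thesis by simp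
qed

lemma cos_scaled_vstrip_nonzero:
  assumes "\<zeta> \<in> vstrip L"
  shows "cos (of_real (pi / (2 * L)) * (\<zeta> + of_real (L / 2))) \<noteq> 0"
  using Re_scaled_vstrip [OF assms] pi_gt_zero by (intro cos_nonzero_of_Re) linarith

lemma has_field_derivative_disk_of_strip:
  assumes "\<zeta> \<in> vstrip L"
  shows "(disk_of_strip L has_field_derivative
    of_real (pi / (2 * L)) / (cos (of_real (pi / (2 * L)) * (\<zeta> + of_real (L / 2))))\<^sup>2) (at \<zeta>)"
proof -
  have "((\<lambda>\<zeta>. of_real (pi / (2 * L)) * (\<zeta> + of_real (L / 2))) has_field_derivative
      complex_of_real (pi / (2 * L))) (at \<zeta>)"
    using L by (auto intro!: derivative_eq_intros)
  from DERIV_chain2 [OF DERIV_tan [OF cos_scaled_vstrip_nonzero [OF assms]] this] show ?thesis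
    unfolding disk_of_strip_def [abs_def] divide_inverse by (simp only: mult.commute)
qed

lemma disk_of_strip_holomorphic: "disk_of_strip L holomorphic_on vstrip L"
  using has_field_derivative_disk_of_strip
  by (meson field_differentiable_at_within field_differentiable_def holomorphic_on_def)

lemma one_minus_norm_disk_of_strip:
  assumes "\<zeta> \<in> vstrip L"
  defines "y \<equiv> of_real (pi / (2 * L)) * (\<zeta> + of_real (L / 2))"
  shows "1 - (norm (disk_of_strip L \<zeta>))\<^sup>2 = cos (2 * Re y) / (norm (cos y))\<^sup>2"
  using one_minus_norm_tan_squared [OF cos_scaled_vstrip_nonzero [OF assms(1)]]
  by (simp add: disk_of_strip_def y_def)

lemma norm_disk_of_strip_less_1:
  assumes "\<zeta> \<in> vstrip L"
  shows "norm (disk_of_strip L \<zeta>) < 1"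
proof -
  have "0 < cos (2 * Re (of_real (pi / (2 * L)) * (\<zeta> + of_real (L / 2))))"
    using Re_scaled_vstrip [OF assms] by (intro cos_gt_zero_pi) linarith+
  then have "0 < 1 - (norm (disk_of_strip L \<zeta>))\<^sup>2"
    unfolding one_minus_norm_disk_of_strip [OF assms]
    using cos_scaled_vstrip_nonzero [OF assms] by (intro divide_pos_pos) auto
  then show ?thesis
    by (simp add: abs_square_less_1)
qed

lemma strip_of_disk_of_strip:
  assumes "\<zeta> \<in> vstrip L"
  shows "strip_of_disk L (disk_of_strip L \<zeta>) = \<zeta>"
proof -
  have "\<bar>Re (of_real (pi / (2 * L)) * (\<zeta> + of_real (L / 2)))\<bar> < pi / 2"
    using Re_scaled_vstrip [OF assms] pi_gt_zero by linarith
  then have "Arctan (disk_of_strip L \<zeta>) = of_real (pi / (2 * L)) * (\<zeta> + of_real (L / 2))"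
    unfolding disk_of_strip_def by (rule Arctan_tan)
  moreover have "complex_of_real L \<noteq> 0"
    using L by simp
  ultimately show ?thesis
    by (simp add: strip_of_disk_def)
qed

lemma disk_of_strip_of_disk:
  assumes "norm w < 1"
  shows "disk_of_strip L (strip_of_disk L w) = w"
  using L tan_Arctan [OF square_neq_minus_1 [OF assms]]
  by (simp add: disk_of_strip_def strip_of_disk_def)

text \<open>\<open>Re_Arctan_bounds\<close> only gives
  \<open>\<bar>Re (Arctan w)\<bar> < pi / 2\<close>. Since \<open>norm w < 1\<close> forces
  \<open>cos (2 * Re (Arctan w))\<close> to be positive, the bound improves to
  \<open>pi / 4\<close>.\<close>

lemma strip_of_disk_in_vstrip:
  assumes "norm w < 1"
  shows "strip_of_disk L w \<in> vstrip L"
proof -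
  let ?R = "Re (Arctan w)"
  have R: "\<bar>?R\<bar> < pi / 2"
    using Re_Arctan_bounds [of w] assms abs_Im_le_cmod [of w] by auto
  have c: "cos (Arctan w) \<noteq> 0" by (rule cos_nonzero_of_Re [OF R])
  have "0 < 1 - (norm w)\<^sup>2"
    using assms by (simp add: abs_square_less_1)
  then have "0 < cos (2 * ?R) / (norm (cos (Arctan w)))\<^sup>2"
    using one_minus_norm_tan_squared [OF c] tan_Arctan [OF square_neq_minus_1 [OF assms]] by simp
  then have pos: "0 < cos \<bar>2 * ?R\<bar>"
    using c by (simp add: zero_less_divide_iff)
  have "\<bar>2 * ?R\<bar> < pi / 2"
  proof (rule ccontr)
    assume "\<not> \<bar>2 * ?R\<bar> < pi / 2"
    then have "cos \<bar>2 * ?R\<bar> \<le> cos (pi / 2)"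
      using R by (intro cos_monotone_0_pi_le) auto
    then show False using pos by simp
  qed
  then have "\<bar>?R\<bar> < pi / 4" by simp
  then have "\<bar>2 * L / pi * ?R\<bar> < 2 * L / pi * (pi / 4)"
    unfolding abs_mult using L by (subst abs_of_pos, simp, intro mult_strict_left_mono) auto
  then have "\<bar>2 * L / pi * ?R\<bar> < L / 2"
    by simp
  moreover have "Re (strip_of_disk L w) = 2 * L / pi * ?R - L / 2"
    by (simp add: strip_of_disk_def)
  ultimately show ?thesis
    unfolding vstrip_def mem_Collect_eq by linarith
qed

lemma strip_of_disk_holomorphic: "strip_of_disk L holomorphic_on ball 0 1"
  unfolding strip_of_disk_def [abs_def]
  by (intro holomorphic_intros holomorphic_on_Arctan) (use abs_Im_le_cmod order_le_less_trans in auto)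

section \<open>Growth of holomorphic maps from the disk to the strip\<close>

text \<open>Schwarz--Pick is applied to \<open>disk_of_strip L \<circ> f\<close>. The factors
  \<open>(norm (cos y))\<^sup>2\<close> cancel, leaving \<open>cos (2 * Re y) \<le> 1\<close>, with
  equality on the central line. In other words, the hyperbolic density of the strip is at least
  \<open>pi / L\<close>.\<close>

lemma norm_deriv_disk_to_strip:
  assumes holf: "f holomorphic_on ball 0 1" and imf: "f ` ball 0 1 \<subseteq> vstrip L" and z: "norm z < 1"
  shows "norm (deriv f z) \<le> 2 * L / pi / (1 - (norm z)\<^sup>2)"
proof -
  define g where "g = disk_of_strip L \<circ> f"
  define y where "y = of_real (pi / (2 * L)) * (f z + of_real (L / 2))"
  have fz: "f z \<in> vstrip L" using imf z by (force simp: image_subset_iff)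
  have df: "(f has_field_derivative deriv f z) (at z)"
    using holf z by (intro holomorphic_derivI [of f "ball 0 1"]) auto
  have cy: "cos y \<noteq> 0" using cos_scaled_vstrip_nonzero [OF fz] by (simp add: y_def)
  have holg: "g holomorphic_on ball 0 1"
    unfolding g_def by (rule holomorphic_on_compose_gen [OF holf disk_of_strip_holomorphic imf])
  have img: "g ` ball 0 1 \<subseteq> ball 0 1"
    using norm_disk_of_strip_less_1 imf by (force simp: g_def image_subset_iff)
  have "(g has_field_derivative of_real (pi / (2 * L)) / (cos y)\<^sup>2 * deriv f z) (at z)"
    unfolding g_def y_def by (rule DERIV_chain [OF has_field_derivative_disk_of_strip [OF fz] df])
  then have dg: "deriv g z = of_real (pi / (2 * L)) / (cos y)\<^sup>2 * deriv f z"
    by (rule DERIV_imp_deriv)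
  have ndg: "norm (deriv g z) = pi / (2 * L) / (norm (cos y))\<^sup>2 * norm (deriv f z)"
    unfolding dg norm_mult norm_divide norm_power norm_of_real using L by simp
  have pos: "0 < 1 - (norm z)\<^sup>2" using z by (simp add: abs_square_less_1)
  have "norm (deriv g z) * (1 - (norm z)\<^sup>2) \<le> 1 - (norm (g z))\<^sup>2"
    by (rule Schwarz_Pick_deriv [OF holg img z])
  also have "\<dots> = cos (2 * Re y) / (norm (cos y))\<^sup>2"
    using one_minus_norm_disk_of_strip [OF fz] by (simp add: g_def y_def)
  also have "\<dots> \<le> 1 / (norm (cos y))\<^sup>2"
    by (intro divide_right_mono) auto
  finally have "pi / (2 * L) * norm (deriv f z) * (1 - (norm z)\<^sup>2) / (norm (cos y))\<^sup>2
      \<le> 1 / (norm (cos y))\<^sup>2"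
    by (simp add: ndg)
  then have "pi / (2 * L) * norm (deriv f z) * (1 - (norm z)\<^sup>2) \<le> 1"
    using cy by (subst (asm) divide_le_cancel) (auto simp: not_less)
  then have "norm (deriv f z) * (1 - (norm z)\<^sup>2) \<le> 2 * L / pi"
    using L by (simp add: field_simps)
  then show ?thesis
    using pos by (simp only: pos_le_divide_eq)
qed

text \<open>The derivative bound is integrated along the radius from 0 to \<open>w\<close>.\<close>

lemma norm_diff_disk_to_strip:
  assumes holf: "f holomorphic_on ball 0 1" and imf: "f ` ball 0 1 \<subseteq> vstrip L" and w: "norm w < 1"
  shows "norm (f w - f 0) \<le> 2 * L / pi * artanh (norm w)"
proof -
  have tw: "norm (of_real t * w) < 1" if "t \<in> {0..1}" for t :: real
  proof -
    have "norm (of_real t * w) \<le> 1 * norm w"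
      unfolding norm_mult using that by (intro mult_right_mono) auto
    then show ?thesis using w by simp
  qed
  have int1: "((\<lambda>t. w * deriv f (of_real t * w)) has_integral (f w - f 0)) {0..1}"
  proof -
    have "((\<lambda>t. f (of_real t * w)) has_vector_derivative w * deriv f (of_real t * w))
        (at t within {0..1})" if t: "t \<in> {0..1}" for t
    proof -
      have "(f has_field_derivative deriv f (of_real t * w)) (at (of_real t * w))"
        using holf tw [OF t] by (intro holomorphic_derivI [of f "ball 0 1"]) auto
      moreover have "((\<lambda>t. of_real t * w) has_vector_derivative w) (at t)"
        by (auto intro!: derivative_eq_intros)
      ultimately have "(f \<circ> (\<lambda>t. of_real t * w) has_vector_derivative
          w * deriv f (of_real t * w)) (at t)"
        by (intro field_vector_diff_chain_at) auto
      then show ?thesis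
        by (simp add: o_def has_vector_derivative_at_within)
    qed
    from fundamental_theorem_of_calculus [OF _ this] show ?thesis by simp
  qed
  have int2: "((\<lambda>t. 2 * L / pi * (norm w / (1 - (t * norm w)\<^sup>2))) has_integral
      2 * L / pi * artanh (norm w)) {0..1}"
    by (intro has_integral_mult_right has_integral_artanh_radius w norm_ge_zero)
  have "norm (integral {0..1} (\<lambda>t. w * deriv f (of_real t * w)))
      \<le> integral {0..1} (\<lambda>t. 2 * L / pi * (norm w / (1 - (t * norm w)\<^sup>2)))"
  proof (rule integral_norm_bound_integral)
    show "norm (w * deriv f (of_real t * w)) \<le> 2 * L / pi * (norm w / (1 - (t * norm w)\<^sup>2))"
      if t: "t \<in> {0..1}" for t
    proof -
      have "norm (deriv f (of_real t * w)) \<le> 2 * L / pi / (1 - (norm (of_real t * w))\<^sup>2)"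
        by (rule norm_deriv_disk_to_strip [OF holf imf tw [OF t]])
      also have "norm (of_real t * w) = t * norm w"
        using t by (simp add: norm_mult)
      finally have "norm w * norm (deriv f (of_real t * w))
          \<le> norm w * (2 * L / pi / (1 - (t * norm w)\<^sup>2))"
        by (rule mult_left_mono) auto
      then show ?thesis by (simp add: norm_mult mult_ac)
    qed
  qed (use int1 int2 in blast)+
  then show ?thesis
    by (simp only: integral_unique [OF int1] integral_unique [OF int2])
qed

end

section \<open>Lifting chains of disks to the strip\<close>

lemma tanh_artanh_real:
  fixes x :: real
  assumes "\<bar>x\<bar> < 1"
  shows "tanh (artanh x) = x"
proof -
  have "exp (2 * artanh x) = (1 + x) / (1 - x)"
    using assms by (simp add: artanh_def)
  then have "exp (- (2 * artanh x)) = (1 - x) / (1 + x)"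
    by (simp add: exp_minus)
  then have "tanh (artanh x) = (1 - (1 - x) / (1 + x)) / (1 + (1 - x) / (1 + x))"
    by (simp add: tanh_real_altdef)
  also have "\<dots> = x"
    using assms by (simp add: field_simps)
  finally show ?thesis .
qed

text \<open>Used with \<open>y = s / 2\<close> to pass between hyperbolic radius \<open>s\<close>
  and Euclidean radius \<open>tanh (s / 2)\<close> around 0.\<close>

lemma artanh_less_iff:
  fixes x y :: real
  assumes "\<bar>x\<bar> < 1"
  shows "artanh x < y \<longleftrightarrow> x < tanh y"
  using tanh_real_less_iff [of "artanh x" y] unfolding tanh_artanh_real [OF assms] by (rule sym)

text \<open>The universal covering of the annulus by the disk. Since
  \<open>Moebius_function 0 (-p)\<close> sends 0 to \<open>p\<close>, varying \<open>p\<close> moves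
  the image of 0 to any prescribed centre.\<close>

definition annulus_cover :: "real \<Rightarrow> complex \<Rightarrow> complex \<Rightarrow> complex" where
  "annulus_cover L p w = exp (strip_of_disk L (Moebius_function 0 (-p) w))"

lemma kobayashi_dist_le:
  assumes "kobayashi_chain X z1 z2 m a b f"
  shows "kobayashi_dist X z1 z2 \<le> (\<Sum>i=1..m. poincare_dist (a i) (b i))"
  unfolding kobayashi_dist_def
proof (rule cInf_lower)
  show "bdd_below {\<Sum>i=1..m. poincare_dist (a i) (b i) | m a b f. kobayashi_chain X z1 z2 m a b f}"
    by (rule bdd_belowI [of _ 0])
       (auto simp: kobayashi_chain_def intro!: sum_nonneg poincare_dist_nonneg)
qed (use assms in blast)

context
  fixes L :: real
  assumes L: "0 < L"
begin

lemma exp_in_round_annulus_iff: "exp \<zeta> \<in> round_annulus (exp (- L)) \<longleftrightarrow> \<zeta> \<in> vstrip L"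
  by (simp add: round_annulus_def vstrip_def norm_exp_eq_Re)

text \<open>A zero-free function on the disk has a holomorphic logarithm. Adding the constant
  \<open>\<zeta> - g a\<close>, whose exponential is 1, prescribes the value at
  \<open>a\<close>.\<close>

lemma holomorphic_lift_to_vstrip:
  assumes holf: "f holomorphic_on ball 0 1" and imf: "f ` ball 0 1 \<subseteq> round_annulus (exp (- L))"
    and a: "norm a < 1" and \<zeta>: "exp \<zeta> = f a"
  obtains g where "g holomorphic_on ball 0 1" "g ` ball 0 1 \<subseteq> vstrip L"
    "\<And>z. norm z < 1 \<Longrightarrow> f z = exp (g z)" "g a = \<zeta>"
proof -
  have nz: "f z \<noteq> 0" if "z \<in> ball 0 1" for z
  proof -
    have "exp (- L) < norm (f z)" using imf that unfolding round_annulus_def by blast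
    then show ?thesis by (metis exp_gt_zero norm_zero not_less_iff_gr_or_eq)
  qed
  obtain g where g: "g holomorphic_on ball 0 1" "\<And>z. z \<in> ball 0 1 \<Longrightarrow> f z = exp (g z)"
    using contractible_imp_holomorphic_log [OF holf convex_imp_contractible [OF convex_ball] nz] by blast
  define h where "h z = g z + (\<zeta> - g a)" for z
  have "exp (\<zeta> - g a) = 1"
    using \<zeta> g(2) [of a] a by (simp add: exp_diff)
  then have fh: "f z = exp (h z)" if "norm z < 1" for z
    using g(2) [of z] that by (simp add: h_def exp_add)
  have "h ` ball 0 1 \<subseteq> vstrip L"
  proof clarify
    fix z :: complex assume "z \<in> ball 0 1"
    then have "exp (h z) \<in> round_annulus (exp (- L))"
      using fh [of z] imf by (metis image_subset_iff mem_ball_0)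
    then show "h z \<in> vstrip L" by (simp add: exp_in_round_annulus_iff)
  qed
  moreover have "h holomorphic_on ball 0 1"
    unfolding h_def by (intro holomorphic_intros g)
  ultimately show ?thesis
    using that [of h] fh by (simp add: h_def)
qed

text \<open>The increments of \<open>2 artanh (Re (F \<zeta>))\<close> along consecutive lifted disks telescope, which
  replaces the triangle inequality for the Poincar\'e distance.\<close>

lemma kobayashi_chain_lift:
  assumes chain: "kobayashi_chain (round_annulus (exp (- L))) z1 z2 m a b f" and \<zeta>0: "exp \<zeta>0 = z1"
  obtains \<zeta> where "exp \<zeta> = z2"
    "\<And>F. \<lbrakk>F holomorphic_on vstrip L; F ` vstrip L \<subseteq> ball 0 1\<rbrakk> \<Longrightarrow>
      2 * artanh (Re (F \<zeta>)) - 2 * artanh (Re (F \<zeta>0)) \<le> (\<Sum>i=1..m. poincare_dist (a i) (b i))"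
proof -
  have m: "1 \<le> m"
    and ch: "\<And>i. 1 \<le> i \<Longrightarrow> i \<le> m \<Longrightarrow> norm (a i) < 1 \<and> norm (b i) < 1 \<and>
      f i holomorphic_on ball 0 1 \<and> f i ` ball 0 1 \<subseteq> round_annulus (exp (- L))"
    and z1: "f 1 (a 1) = z1" and z2: "f m (b m) = z2"
    and link: "\<And>i. 1 \<le> i \<Longrightarrow> i < m \<Longrightarrow> f i (b i) = f (Suc i) (a (Suc i))"
    using chain by (auto simp: kobayashi_chain_def)
  \<comment> \<open>The endpoint \<open>\<zeta>'\<close> is fixed before \<open>F\<close> is
    quantified, because the test map chosen later depends on the endpoint of the lifted
    chain.\<close>
  have step: "\<exists>\<zeta>'. exp \<zeta>' = f i (b i) \<and> (\<forall>F. F holomorphic_on vstrip L \<and> F ` vstrip L \<subseteq> ball 0 1 \<longrightarrow>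
      2 * artanh (Re (F \<zeta>')) - 2 * artanh (Re (F \<zeta>)) \<le> poincare_dist (a i) (b i))"
    if i: "1 \<le> i" "i \<le> m" and \<zeta>: "exp \<zeta> = f i (a i)" for i \<zeta>
  proof -
    obtain g where g: "g holomorphic_on ball 0 1" "g ` ball 0 1 \<subseteq> vstrip L"
      "\<And>z. norm z < 1 \<Longrightarrow> f i z = exp (g z)" "g (a i) = \<zeta>"
      using holomorphic_lift_to_vstrip [of "f i" "a i" \<zeta>] ch [OF i] \<zeta> by blast
    have "2 * artanh (Re (F (g (b i)))) - 2 * artanh (Re (F \<zeta>)) \<le> poincare_dist (a i) (b i)"
      if F: "F holomorphic_on vstrip L" "F ` vstrip L \<subseteq> ball 0 1" for F
    proof -
      have "F \<circ> g holomorphic_on ball 0 1"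
        by (rule holomorphic_on_compose_gen [OF g(1) F(1) g(2)])
      moreover have "(F \<circ> g) ` ball 0 1 \<subseteq> ball 0 1"
        using g(2) F(2) by (auto simp: image_subset_iff)
      ultimately show ?thesis
        using artanh_Re_diff_le_poincare_dist [of "F \<circ> g" "a i" "b i"] ch [OF i] g(4) by simp
    qed
    then show ?thesis
      using g(3) [of "b i"] ch [OF i] by (intro exI [of _ "g (b i)"]) auto
  qed
  have "\<exists>\<zeta>. exp \<zeta> = f k (b k) \<and> (\<forall>F. F holomorphic_on vstrip L \<and> F ` vstrip L \<subseteq> ball 0 1 \<longrightarrow>
      2 * artanh (Re (F \<zeta>)) - 2 * artanh (Re (F \<zeta>0)) \<le> (\<Sum>i=1..k. poincare_dist (a i) (b i)))"
    if "1 \<le> k" "k \<le> m" for k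
    using that
  proof (induction k rule: nat_induct_at_least)
    case base
    then show ?case using step [of 1 \<zeta>0] \<zeta>0 z1 by simp
  next
    case (Suc k)
    then obtain \<zeta> where \<zeta>: "exp \<zeta> = f k (b k)"
      and F1: "\<And>F. F holomorphic_on vstrip L \<Longrightarrow> F ` vstrip L \<subseteq> ball 0 1 \<Longrightarrow>
        2 * artanh (Re (F \<zeta>)) - 2 * artanh (Re (F \<zeta>0)) \<le> (\<Sum>i=1..k. poincare_dist (a i) (b i))"
      by auto
    have "exp \<zeta> = f (Suc k) (a (Suc k))"
      using \<zeta> link [of k] Suc by simp
    then obtain \<zeta>' where \<zeta>': "exp \<zeta>' = f (Suc k) (b (Suc k))"
      and F2: "\<And>F. F holomorphic_on vstrip L \<Longrightarrow> F ` vstrip L \<subseteq> ball 0 1 \<Longrightarrow>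
        2 * artanh (Re (F \<zeta>')) - 2 * artanh (Re (F \<zeta>)) \<le> poincare_dist (a (Suc k)) (b (Suc k))"
      using step [of "Suc k" \<zeta>] Suc by auto
    show ?case
    proof (intro exI [of _ \<zeta>'] conjI allI impI)
      fix F assume "F holomorphic_on vstrip L \<and> F ` vstrip L \<subseteq> ball 0 1"
      then show "2 * artanh (Re (F \<zeta>')) - 2 * artanh (Re (F \<zeta>0))
          \<le> (\<Sum>i=1..Suc k. poincare_dist (a i) (b i))"
        using F1 [of F] F2 [of F] by simp
    qed (rule \<zeta>')
  qed
  from this [OF m order_refl] show ?thesis
    using that z2 by auto
qed

section \<open>Kobayashi balls in the annulus\<close>

lemma Moebius_strip_holomorphic:
  assumes "norm p < 1"
  shows "(\<lambda>w. strip_of_disk L (Moebius_function 0 (-p) w)) holomorphic_on ball 0 1"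
    and "(\<lambda>w. strip_of_disk L (Moebius_function 0 (-p) w)) ` ball 0 1 \<subseteq> vstrip L"
proof -
  have p: "norm (-p) < 1" using assms by simp
  have "Moebius_function 0 (-p) ` ball 0 1 \<subseteq> ball 0 1"
    using Moebius_function_norm_lt_1 [OF p] by auto
  from holomorphic_on_compose_gen [OF Moebius_function_holomorphic [OF p] strip_of_disk_holomorphic [OF L] this]
  show "(\<lambda>w. strip_of_disk L (Moebius_function 0 (-p) w)) holomorphic_on ball 0 1"
    by (simp add: o_def)
  show "(\<lambda>w. strip_of_disk L (Moebius_function 0 (-p) w)) ` ball 0 1 \<subseteq> vstrip L"
    using strip_of_disk_in_vstrip [OF L] Moebius_function_norm_lt_1 [OF p] by auto
qed

lemma annulus_cover_holomorphic:
  assumes "norm p < 1"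
  shows "annulus_cover L p holomorphic_on ball 0 1"
  unfolding annulus_cover_def [abs_def]
  by (intro holomorphic_intros Moebius_strip_holomorphic assms)

lemma annulus_cover_in_annulus:
  assumes "norm p < 1"
  shows "annulus_cover L p ` ball 0 1 \<subseteq> round_annulus (exp (- L))"
  using Moebius_strip_holomorphic(2) [OF assms]
  by (auto simp: annulus_cover_def exp_in_round_annulus_iff)

lemma annulus_cover_0: "annulus_cover L p 0 = exp (strip_of_disk L p)"
  by (simp add: annulus_cover_def Moebius_function_of_zero)

lemma annulus_cover_Moebius_disk_of_strip:
  assumes p: "norm p < 1" and \<zeta>: "\<zeta> \<in> vstrip L"
  shows "annulus_cover L p (Moebius_function 0 p (disk_of_strip L \<zeta>)) = exp \<zeta>"
  using Moebius_function_compose [of "-p" p "disk_of_strip L \<zeta>"] p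
    norm_disk_of_strip_less_1 [OF L \<zeta>] strip_of_disk_of_strip [OF L \<zeta>]
  by (simp add: annulus_cover_def)

lemma in_round_annulus_imp_annulus_cover_0:
  assumes "z \<in> round_annulus (exp (- L))"
  obtains p where "norm p < 1" "z = annulus_cover L p 0"
proof -
  have "z \<noteq> 0" using assms by (auto simp: round_annulus_def not_less)
  then have z: "exp (Ln z) = z" by simp
  then have "Ln z \<in> vstrip L" using assms exp_in_round_annulus_iff by metis
  then show ?thesis
    using that [of "disk_of_strip L (Ln z)"] norm_disk_of_strip_less_1 [OF L] z
    by (simp add: annulus_cover_0 strip_of_disk_of_strip [OF L])
qed

text \<open>A single disk joins the two points. This bounds the distance from above and shows that
  chains exist.\<close>

lemma kobayashi_chain_annulus_cover:
  assumes "norm p < 1" "norm q < 1"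
  shows "kobayashi_chain (round_annulus (exp (- L))) (annulus_cover L p 0) (annulus_cover L p q)
    1 (\<lambda>_. 0) (\<lambda>_. q) (\<lambda>_. annulus_cover L p)"
  using assms annulus_cover_holomorphic annulus_cover_in_annulus by (simp add: kobayashi_chain_def)

text \<open>One inclusion comes from the one-disk chain of length at most
  \<open>2 * artanh (norm q)\<close>. For the other, a chain shorter than \<open>s\<close> is lifted
  to the strip, and its endpoint is located by a test map vanishing at the lift of the
  centre.\<close>

lemma kobayashi_ball_round_annulus:
  assumes p: "norm p < 1"
  shows "kobayashi_ball (round_annulus (exp (- L))) (annulus_cover L p 0) s
    = annulus_cover L p ` ball 0 (tanh (s / 2))"
proof (intro equalityI subsetI)
  fix w assume "w \<in> annulus_cover L p ` ball 0 (tanh (s / 2))"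
  then obtain q where q: "norm q < tanh (s / 2)" and w: "w = annulus_cover L p q" by auto
  have q1: "norm q < 1" using q tanh_real_lt_1 [of "s / 2"] by linarith
  have "kobayashi_dist (round_annulus (exp (- L))) (annulus_cover L p 0) w \<le> poincare_dist 0 q"
    using kobayashi_dist_le [OF kobayashi_chain_annulus_cover [OF p q1]] by (simp add: w)
  also have "\<dots> \<le> 2 * artanh (norm q)" by (rule poincare_dist_0_le [OF q1])
  also have "\<dots> < s" using artanh_less_iff [of "norm q" "s / 2"] q q1 by simp
  finally show "w \<in> kobayashi_ball (round_annulus (exp (- L))) (annulus_cover L p 0) s"
    using annulus_cover_in_annulus [OF p] q1 by (force simp: kobayashi_ball_def w)
next
  fix w assume "w \<in> kobayashi_ball (round_annulus (exp (- L))) (annulus_cover L p 0) s"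
  then have wA: "w \<in> round_annulus (exp (- L))"
    and lt: "kobayashi_dist (round_annulus (exp (- L))) (annulus_cover L p 0) w < s"
    by (auto simp: kobayashi_ball_def)
  let ?Q = "{\<Sum>i=1..m. poincare_dist (a i) (b i) | m a b f.
      kobayashi_chain (round_annulus (exp (- L))) (annulus_cover L p 0) w m a b f}"
  \<comment> \<open>\<open>cInf_lessD\<close> extracts a chain of length below \<open>s\<close> only
    from a nonempty set.\<close>
  have "?Q \<noteq> {}"
  proof -
    obtain p' where p': "norm p' < 1" "w = annulus_cover L p' 0"
      using in_round_annulus_imp_annulus_cover_0 [OF wA] .
    have \<zeta>: "strip_of_disk L p' \<in> vstrip L" by (rule strip_of_disk_in_vstrip [OF L p'(1)])
    have "w = annulus_cover L p (Moebius_function 0 p (disk_of_strip L (strip_of_disk L p')))"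
      using annulus_cover_Moebius_disk_of_strip [OF p \<zeta>] p' by (simp add: annulus_cover_0)
    moreover have "norm (Moebius_function 0 p (disk_of_strip L (strip_of_disk L p'))) < 1"
      by (intro Moebius_function_norm_lt_1 p norm_disk_of_strip_less_1 [OF L] \<zeta>)
    ultimately show ?thesis
      using kobayashi_chain_annulus_cover [OF p] by fastforce
  qed
  then obtain m a b f where
    chain: "kobayashi_chain (round_annulus (exp (- L))) (annulus_cover L p 0) w m a b f"
    and sum: "(\<Sum>i=1..m. poincare_dist (a i) (b i)) < s"
    using cInf_lessD [of ?Q s] lt unfolding kobayashi_dist_def by blast
  obtain \<zeta> where \<zeta>: "exp \<zeta> = w"
    and F: "\<And>F. \<lbrakk>F holomorphic_on vstrip L; F ` vstrip L \<subseteq> ball 0 1\<rbrakk> \<Longrightarrow>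
      2 * artanh (Re (F \<zeta>)) - 2 * artanh (Re (F (strip_of_disk L p)))
        \<le> (\<Sum>i=1..m. poincare_dist (a i) (b i))"
    using kobayashi_chain_lift [OF chain annulus_cover_0 [symmetric]] by metis
  have \<zeta>in: "\<zeta> \<in> vstrip L" using wA \<zeta> exp_in_round_annulus_iff by metis
  define M where "M \<xi> = Moebius_function 0 p (disk_of_strip L \<xi>)" for \<xi>
  have M_lt: "norm (M \<xi>) < 1" if "\<xi> \<in> vstrip L" for \<xi>
    unfolding M_def by (intro Moebius_function_norm_lt_1 p norm_disk_of_strip_less_1 [OF L] that)
  have "disk_of_strip L ` vstrip L \<subseteq> ball 0 1"
    using norm_disk_of_strip_less_1 [OF L] by auto
  from holomorphic_on_compose_gen [OF disk_of_strip_holomorphic [OF L] Moebius_function_holomorphic [OF p] this]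
  have holM: "M holomorphic_on vstrip L"
    by (simp add: M_def [abs_def] o_def)
  \<comment> \<open>Multiplication by \<open>u\<close> rotates \<open>M \<zeta>\<close> onto the
    nonnegative real axis, so that taking the real part loses nothing. If
    \<open>M \<zeta> = 0\<close>, then \<open>sgn\<close> returns 0 and \<open>u = 0\<close>, hence
    only \<open>norm u \<le> 1\<close>.\<close>
  define u where "u = cnj (sgn (M \<zeta>))"
  have u: "norm u \<le> 1" by (simp add: u_def norm_sgn)
  have uM: "u * M \<zeta> = of_real (norm (M \<zeta>))"
  proof (cases "M \<zeta> = 0")
    case False
    have "cnj (M \<zeta>) * M \<zeta> = (of_real (norm (M \<zeta>)))\<^sup>2"
      by (metis complex_norm_square mult.commute of_real_power)
    then show ?thesis
      using False by (simp add: u_def sgn_eq power2_eq_square field_simps)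
  qed (simp add: u_def)
  have Mp: "M (strip_of_disk L p) = 0"
    by (simp add: M_def disk_of_strip_of_disk [OF L p] Moebius_function_eq_zero)
  have "(\<lambda>\<xi>. u * M \<xi>) ` vstrip L \<subseteq> ball 0 1"
  proof clarsimp
    fix \<xi> assume "\<xi> \<in> vstrip L"
    then have "norm u * norm (M \<xi>) \<le> 1 * norm (M \<xi>)" "norm (M \<xi>) < 1"
      using u M_lt by (blast intro: mult_right_mono norm_ge_zero)+
    then show "norm (u * M \<xi>) < 1" by (simp add: norm_mult)
  qed
  moreover have "(\<lambda>\<xi>. u * M \<xi>) holomorphic_on vstrip L"
    by (intro holomorphic_intros holM)
  ultimately have "2 * artanh (Re (u * M \<zeta>)) - 2 * artanh (Re (u * M (strip_of_disk L p)))
      \<le> (\<Sum>i=1..m. poincare_dist (a i) (b i))"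
    using F by blast
  then have "artanh (norm (M \<zeta>)) < s / 2"
    using sum by (simp add: uM Mp del: times_complex.sel)
  then have "norm (M \<zeta>) < tanh (s / 2)"
    using artanh_less_iff [of "norm (M \<zeta>)" "s / 2"] M_lt [OF \<zeta>in] by simp
  moreover have "w = annulus_cover L p (M \<zeta>)"
    using annulus_cover_Moebius_disk_of_strip [OF p \<zeta>in] by (simp add: M_def \<zeta>)
  ultimately show "w \<in> annulus_cover L p ` ball 0 (tanh (s / 2))" by simp
qed

section \<open>Balls of radius \<open>pi\<^sup>2 / L\<close> are simply connected\<close>

text \<open>Lifted points stay within distance less than \<open>pi\<close> of the lifted centre, so
  two of them differ by less than \<open>2 * pi\<close>. Points with equal exponential differ by a
  multiple of \<open>2 * pi * \<i>\<close>, hence coincide.\<close>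

lemma inj_on_annulus_cover:
  assumes p: "norm p < 1"
  shows "inj_on (annulus_cover L p) (ball 0 (tanh (pi\<^sup>2 / L / 2)))"
proof (rule inj_onI)
  let ?h = "\<lambda>w. strip_of_disk L (Moebius_function 0 (-p) w)"
  fix w1 w2
  assume w: "w1 \<in> ball 0 (tanh (pi\<^sup>2 / L / 2))" "w2 \<in> ball 0 (tanh (pi\<^sup>2 / L / 2))"
    and eq: "annulus_cover L p w1 = annulus_cover L p w2"
  have bound: "norm (?h w - ?h 0) < pi" and lt1: "norm w < 1"
    if w: "w \<in> ball 0 (tanh (pi\<^sup>2 / L / 2))" for w
  proof -
    show w1: "norm w < 1" using w tanh_real_lt_1 [of "pi\<^sup>2 / L / 2"] by simp
    have "norm (?h w - ?h 0) \<le> 2 * L / pi * artanh (norm w)"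
      by (rule norm_diff_disk_to_strip [OF L Moebius_strip_holomorphic [OF p] w1])
    \<comment> \<open>The radius \<open>pi\<^sup>2 / L\<close> is the one for which this product
      equals \<open>pi\<close>.\<close>
    also have "\<dots> < 2 * L / pi * (pi\<^sup>2 / L / 2)"
      using artanh_less_iff [of "norm w" "pi\<^sup>2 / L / 2"] w w1 L by (intro mult_strict_left_mono) auto
    also have "\<dots> = pi" using L by (simp add: power2_eq_square)
    finally show "norm (?h w - ?h 0) < pi" .
  qed
  have "exp (?h w1) = exp (?h w2)" using eq by (simp add: annulus_cover_def)
  then obtain n :: int where n: "?h w1 = ?h w2 + of_real (of_int (2 * n) * pi) * \<i>"
    unfolding exp_eq by blast
  have "norm (?h w1 - ?h w2) < 2 * pi"
    using norm_triangle_ineq4 [of "?h w1 - ?h 0" "?h w2 - ?h 0"] bound [OF w(1)] bound [OF w(2)] by simp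
  moreover have "norm (?h w1 - ?h w2) = 2 * pi * \<bar>of_int n\<bar>"
    by (simp add: n norm_mult)
  ultimately have "\<bar>of_int n\<bar> < (1::real)" by simp
  then have "n = 0" by linarith
  then have "?h w1 = ?h w2" using n by simp
  then have "Moebius_function 0 (-p) w1 = Moebius_function 0 (-p) w2"
    using disk_of_strip_of_disk [OF L] Moebius_function_norm_lt_1 [of "-p"] p lt1 [OF w(1)] lt1 [OF w(2)]
    by (metis norm_minus_cancel)
  then show "w1 = w2"
    using Moebius_function_compose [of p "-p"] p lt1 [OF w(1)] lt1 [OF w(2)] by metis
qed

text \<open>By invariance of domain the injective covering map is a homeomorphism from a Euclidean
  disk onto the ball.\<close>

lemma simply_connected_kobayashi_ball:
  assumes "z \<in> round_annulus (exp (- L))"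
  shows "simply_connected (kobayashi_ball (round_annulus (exp (- L))) z (pi\<^sup>2 / L))"
proof -
  obtain p where p: "norm p < 1" and z: "z = annulus_cover L p 0"
    using in_round_annulus_imp_annulus_cover_0 [OF assms] .
  let ?B = "ball 0 (tanh (pi\<^sup>2 / L / 2)) :: complex set"
  have "?B \<subseteq> ball 0 1"
    by (intro subset_ball less_imp_le tanh_real_lt_1)
  then have "continuous_on ?B (annulus_cover L p)"
    using annulus_cover_holomorphic [OF p] holomorphic_on_imp_continuous_on holomorphic_on_subset by blast
  then have "?B homeomorphic annulus_cover L p ` ?B"
    using inj_on_annulus_cover [OF p] by (intro invariance_of_domain_homeomorphic) auto
  then show ?thesis
    unfolding z kobayashi_ball_round_annulus [OF p]
    using homeomorphic_simply_connected convex_imp_simply_connected convex_ball by blast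
qed

section \<open>Larger balls around a core point\<close>

text \<open>The centre is \<open>exp (- L / 2)\<close>. The principal logarithm of a point of the
  core circle lies on the central line at height at most \<open>pi\<close> in absolute value. On
  that line \<open>disk_of_strip\<close> takes the values \<open>\<i> * tanh y\<close>, here with
  \<open>\<bar>y\<bar> \<le> pi\<^sup>2 / L / 2\<close>. Height \<open>pi\<close> does occur, which
  is why \<open>s\<close> must be strictly larger than \<open>pi\<^sup>2 / L\<close>.\<close>

lemma core_circle_subset_kobayashi_ball:
  assumes s: "pi\<^sup>2 / L < s"
  shows "sphere 0 (exp (- L / 2)) \<subseteq> kobayashi_ball (round_annulus (exp (- L))) (annulus_cover L 0 0) s"
proof
  fix w :: complex assume "w \<in> sphere 0 (exp (- L / 2))"
  then have nw: "norm w = exp (- L / 2)" by simp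
  define \<theta> where "\<theta> = Im (Ln w)"
  define \<zeta> where "\<zeta> = of_real (- L / 2) + \<i> * of_real \<theta>"
  define y where "y = pi / (2 * L) * \<theta>"
  have w0: "w \<noteq> 0" using nw by auto
  have "Re (Ln w) = - L / 2" using w0 nw by simp
  then have "Ln w = \<zeta>" by (simp add: complex_eq_iff \<zeta>_def \<theta>_def)
  then have w: "w = exp \<zeta>" using w0 by (metis exp_Ln)
  have \<zeta>in: "\<zeta> \<in> vstrip L" using L by (simp add: \<zeta>_def vstrip_def)
  have "of_real (pi / (2 * L)) * (\<zeta> + of_real (L / 2)) = \<i> * of_real y"
    by (simp add: \<zeta>_def y_def)
  then have "disk_of_strip L \<zeta> = tan (\<i> * of_real y)" by (simp add: disk_of_strip_def)
  also have "\<dots> = \<i> * of_real (tanh y)"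
  proof -
    have "tan (\<i> * of_real y) = \<i> * tanh (complex_of_real y)"
      by (simp add: tanh_conv_tan)
    also have "tanh (complex_of_real y) = of_real (tanh y)"
      by (simp add: tanh_def sinh_def cosh_def scaleR_conv_of_real exp_of_real [symmetric] flip: of_real_minus)
    finally show ?thesis .
  qed
  finally have "norm (disk_of_strip L \<zeta>) = \<bar>tanh y\<bar>" by (simp add: norm_mult)
  also have "\<dots> = tanh \<bar>y\<bar>" by simp
  also have "\<dots> < tanh (s / 2)"
  proof -
    have "\<bar>\<theta>\<bar> \<le> pi" using w0 mpi_less_Im_Ln [of w] Im_Ln_le_pi [of w] by (simp add: \<theta>_def abs_le_iff)
    then have "\<bar>y\<bar> \<le> pi / (2 * L) * pi"
      unfolding y_def abs_mult using L by (subst abs_of_pos, simp) (intro mult_left_mono, auto)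
    also have "\<dots> = pi\<^sup>2 / L / 2" by (simp add: power2_eq_square)
    also have "\<dots> < s / 2" using s by (rule divide_strict_right_mono) simp
    finally have "\<bar>y\<bar> < s / 2" .
    then show ?thesis by (simp only: tanh_real_less_iff)
  qed
  finally have "norm (disk_of_strip L \<zeta>) < tanh (s / 2)" .
  moreover have "w = annulus_cover L 0 (disk_of_strip L \<zeta>)"
    by (simp add: w annulus_cover_def Moebius_function_def strip_of_disk_of_strip [OF L \<zeta>in])
  ultimately show "w \<in> kobayashi_ball (round_annulus (exp (- L))) (annulus_cover L 0 0) s"
    by (simp add: kobayashi_ball_round_annulus)
qed

text \<open>The core circle lies in the ball and winds once around 0, a point outside the
  ball.\<close>

lemma not_simply_connected_kobayashi_ball:
  assumes "pi\<^sup>2 / L < s"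
  shows "\<not> simply_connected (kobayashi_ball (round_annulus (exp (- L))) (annulus_cover L 0 0) s)"
proof
  let ?B = "kobayashi_ball (round_annulus (exp (- L))) (annulus_cover L 0 0) s"
  let ?c = "circlepath 0 (exp (- L / 2))"
  assume "simply_connected ?B"
  moreover have "path_image ?c \<subseteq> ?B"
    using core_circle_subset_kobayashi_ball [OF assms] by simp
  moreover have "0 \<notin> ?B"
    by (auto simp: kobayashi_ball_def round_annulus_def not_less)
  ultimately have "winding_number ?c 0 = 0"
    by (intro simply_connected_imp_winding_number_zero) auto
  then show False
    by (simp add: winding_number_circlepath)
qed

section \<open>The value of the injectivity radius\<close>

text \<open>The radius \<open>s = pi\<^sup>2 / L\<close> is admissible at every centre, which bounds
  the infimum from below. At a core point no larger radius is admissible, so the infimum is attained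
  there.\<close>

lemma kobayashi_injrad_round_annulus_exp:
  "kobayashi_injrad (round_annulus (exp (- L))) = tanh (pi\<^sup>2 / L / 2)"
proof (rule antisym)
  let ?A = "round_annulus (exp (- L))"
  have ge: "tanh (pi\<^sup>2 / L / 2) \<le> kobayashi_injrad_at ?A z" if z: "z \<in> ?A" for z
    unfolding kobayashi_injrad_at_def
  proof (rule cSup_upper)
    show "tanh (pi\<^sup>2 / L / 2) \<in> {tanh (s / 2) |s. s > 0 \<and> simply_connected (kobayashi_ball ?A z s)}"
      using simply_connected_kobayashi_ball [OF z] L by (intro CollectI exI [of _ "pi\<^sup>2 / L"]) auto
    show "bdd_above {tanh (s / 2) |s. s > 0 \<and> simply_connected (kobayashi_ball ?A z s)}"
      by (rule bdd_aboveI [of _ 1]) (auto intro: less_imp_le tanh_real_lt_1)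
  qed
  have core: "annulus_cover L 0 0 \<in> ?A"
    using annulus_cover_in_annulus [of 0] by force
  then show "tanh (pi\<^sup>2 / L / 2) \<le> kobayashi_injrad ?A"
    unfolding kobayashi_injrad_def using ge by (intro cINF_greatest) auto
  have "kobayashi_injrad_at ?A (annulus_cover L 0 0) \<le> tanh (pi\<^sup>2 / L / 2)"
    unfolding kobayashi_injrad_at_def
  proof (rule cSup_least)
    show "{tanh (s / 2) |s. s > 0 \<and> simply_connected (kobayashi_ball ?A (annulus_cover L 0 0) s)} \<noteq> {}"
      using simply_connected_kobayashi_ball [OF core] L by (auto intro!: exI [of _ "pi\<^sup>2 / L"])
    fix x assume "x \<in> {tanh (s / 2) |s. s > 0 \<and> simply_connected (kobayashi_ball ?A (annulus_cover L 0 0) s)}"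
    then obtain s where s: "x = tanh (s / 2)" "simply_connected (kobayashi_ball ?A (annulus_cover L 0 0) s)"
      by auto
    then have "s \<le> pi\<^sup>2 / L" using not_simply_connected_kobayashi_ball [of s] by linarith
    then show "x \<le> tanh (pi\<^sup>2 / L / 2)" by (simp add: s(1))
  qed
  moreover have "kobayashi_injrad ?A \<le> kobayashi_injrad_at ?A (annulus_cover L 0 0)"
    unfolding kobayashi_injrad_def using ge core by (intro cINF_lower bdd_belowI2) auto
  ultimately show "kobayashi_injrad ?A \<le> tanh (pi\<^sup>2 / L / 2)" by linarith
qed

end

theorem corollary3p2:
  fixes r :: real
  assumes "0 < r" and "r < 1"
  shows "let lam = exp (pi\<^sup>2 / ln r) in
           kobayashi_injrad (round_annulus r) = (1 - lam) / (1 + lam)"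
proof -
  \<comment> \<open>With \<open>L = - ln r\<close> and \<open>x = pi\<^sup>2 / L / 2\<close>, the
    factor \<open>exp (- 2 * x)\<close> in
    \<open>tanh x = (1 - exp (- 2 * x)) / (1 + exp (- 2 * x))\<close> is \<open>lam\<close>.\<close>
  have "0 < - ln r" using assms by simp
  from kobayashi_injrad_round_annulus_exp [OF this] show ?thesis
    using assms by (simp add: tanh_real_altdef Let_def)
qed

end
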